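(* Let $n\ge 1$ and let $f:\mathbb R^n\to\mathbb R$ satisfy the standing assumptions (A1)–(A3) stated in the context. For each $t>0$, the function $P_tf$ is coercive (that is, $(P_tf)(x)\to\infty$ as $\|x\|_2\to\infty$) and therefore admits at least one global minimizer $x_t\in\operatorname*{arg\,min}_{x\in\mathbb R^n}P_tf$. Moreover, any such global minimizer satisfies $\nabla(P_tf)(x_t)=0$.
   Context: Notation: $\|\cdot\|_2$ is the Euclidean norm on $\mathbb R^n$ and $B_\rho(0)=\{x:\|x\|_2<\rho\}$. For $t>0$ the heat kernel is $G_t(y)=\frac{1}{(4\pi t)^{n/2}}e^{-\|y\|_2^2/(4t)}$, and the heat-kernel regularization of $f$ is $(P_tf)(x)=\int_{\mathbb R^n}G_t(x-y)f(y)\,dy$. For $a\in[1,2]$, $\Phi_a(x)=\sum_{i=1}^n|x_i|^a$. Standing assumptions on the (Lebesgue measurable) function $f:\mathbb R^n\to\mathbb R$: (A1) Global quadratic lower bound: there is a constant $c>0$ with $f(x)\ge c\|x\|_2^2$ for all $x\in\mathbb R^n$. The distinguished minimizer is at the origin, with $f(0)=0$. (A2) Local leading-order profile: there exist $a\in[1,2]$, $r_0>0$, a function $r:\mathbb R^n\to\mathbb R$ and a function $\omega:[0,r_0)\to[0,\infty)$ with $\lim_{\rho\to0^+}\omega(\rho)=0$ such that $f(x)=\Phi_a(x)+r(x)$ and $|r(x)|\le\omega(\|x\|_2)\,\Phi_a(x)$ for all $x\in B_{r_0}(0)$. (A3) Polynomial tail control: there exist constants $C>0$ and $m\ge2$ such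 that $f(x)\le C(1+\|x\|_2^m)$ for all $x\in\mathbb R^n$. *)

theory Defs
  imports "HOL-Analysis.Analysis"
begin

definition heat_kernel :: "real \<Rightarrow> real ^ 'n \<Rightarrow> real" where
  "heat_kernel t y = 1 / (4 * pi * t) powr (real CARD('n) / 2) * exp (- (norm y)\<^sup>2 / (4 * t))"

text \<open>A Bochner integral with respect to Lebesgue measure, which is 0 by convention if the
  integrand is not integrable. Under the standing assumptions below it is integrable for all
  \<open>t > 0\<close> and \<open>x\<close>.\<close>
definition heat_reg :: "real \<Rightarrow> (real ^ 'n \<Rightarrow> real) \<Rightarrow> real ^ 'n \<Rightarrow> real" where
  "heat_reg t f x = (LINT y|lebesgue. heat_kernel t (x - y) * f y)"

definition Phi :: "real \<Rightarrow> real ^ 'n \<Rightarrow> real" where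
  "Phi a x = (\<Sum>i\<in>UNIV. \<bar>x $ i\<bar> powr a)"

text \<open>That the origin is a global minimizer needs no separate clause: it follows from the bound
  and \<open>f 0 = 0\<close>.\<close>
definition quadratic_lower_bound :: "(real ^ 'n \<Rightarrow> real) \<Rightarrow> bool" where
  "quadratic_lower_bound f \<longleftrightarrow> (\<exists>c>0. \<forall>x. f x \<ge> c * (norm x)\<^sup>2) \<and> f 0 = 0"

text \<open>The modulus \<open>\<omega>\<close> is only constrained on its mathematical domain \<open>[0, r0)\<close>; its values
  elsewhere are irrelevant.\<close>
definition leading_order_profile :: "(real ^ 'n \<Rightarrow> real) \<Rightarrow> bool" where
  "leading_order_profile f \<longleftrightarrow>
    (\<exists>a\<in>{1..2}. \<exists>r0>0. \<exists>(r :: real ^ 'n \<Rightarrow> real) (\<omega> :: real \<Rightarrow> real).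
      (\<forall>\<rho>\<in>{0..<r0}. \<omega> \<rho> \<ge> 0) \<and> (\<omega> \<longlongrightarrow> 0) (at_right 0) \<and>
      (\<forall>x\<in>ball 0 r0. f x = Phi a x + r x \<and> \<bar>r x\<bar> \<le> \<omega> (norm x) * Phi a x))"

definition polynomial_tail :: "(real ^ 'n \<Rightarrow> real) \<Rightarrow> bool" where
  "polynomial_tail f \<longleftrightarrow> (\<exists>C>0. \<exists>m::real. m \<ge> 2 \<and> (\<forall>x. f x \<le> C * (1 + norm x powr m)))"

definition coercive :: "(real ^ 'n \<Rightarrow> real) \<Rightarrow> bool" where
  "coercive g \<longleftrightarrow> filterlim g at_top at_infinity"

abbreviation global_minimizer :: "(real ^ 'n \<Rightarrow> real) \<Rightarrow> real ^ 'n \<Rightarrow> bool" where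
  "global_minimizer g x \<equiv> is_arg_min g (\<lambda>_. True) x"

end

theory Submission
  imports Defs "HOL-Probability.Distributions" "HOL-Real_Asymp.Real_Asymp"
begin

text \<open>
  The tail bound makes \<open>f\<close> grow at most exponentially, so the integrand of \<open>P\<^sub>t f\<close> is dominated,
  uniformly for \<open>x\<close> in a ball, by an integrable function of the form
  \<open>exp (b |y| - |y|\<^sup>2 / (4 t))\<close>. Dominated convergence gives continuity, and restricting the
  integral to the unit ball around \<open>x\<close> gives a quadratic lower bound, hence coercivity and a
  minimizer. Differentiation under the integral is avoided: at a minimizer the increments of
  \<open>P\<^sub>t f\<close> are nonnegative, so each is bounded by the symmetric second difference, and that is
  \<open>O(|h|\<^sup>2)\<close> because the one of \<open>G\<^sub>t\<close> is at most \<open>|h|\<^sup>2\<close> times an integrable function.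
\<close>

section \<open>Integrability of Gaussians with a linear term in the exponent\<close>

lemma integrable_exp_neg_square:
  fixes k :: real
  assumes "k > 0"
  shows "integrable lborel (\<lambda>x. exp (- k * x\<^sup>2))"
proof -
  \<comment> \<open>This standard deviation makes the integrand a constant multiple of a centred
    normal density.\<close>
  define \<sigma> where "\<sigma> = 1 / sqrt (2 * k)"
  have \<sigma>: "\<sigma> > 0" "2 * \<sigma>\<^sup>2 = 1 / k"
    using assms by (simp_all add: \<sigma>_def power_divide)
  have "integrable lborel (\<lambda>x. sqrt (2 * pi * \<sigma>\<^sup>2) * normal_density 0 \<sigma> x)"
    using \<sigma>(1) by (intro integrable_mult_right integrable_normal_density)
  moreover have "sqrt (2 * pi * \<sigma>\<^sup>2) * normal_density 0 \<sigma> x = exp (- k * x\<^sup>2)" for x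
    unfolding normal_density_def using \<sigma> by (simp add: mult.commute)
  ultimately show ?thesis by simp
qed

text \<open>The Gaussian factorizes over the coordinates, so its integral is a product of finite
  one-dimensional ones.\<close>

lemma integrable_exp_neg_norm_square:
  fixes k :: real
  assumes "k > 0"
  shows "integrable lborel (\<lambda>x::'a::euclidean_space. exp (- k * (norm x)\<^sup>2))"
proof (rule integrableI_nonneg)
  have "exp (- k * (norm x)\<^sup>2) = (\<Prod>b\<in>Basis. exp (- k * (x \<bullet> b)\<^sup>2))" for x :: 'a
  proof -
    have "(norm x)\<^sup>2 = (\<Sum>b\<in>Basis. (x \<bullet> b)\<^sup>2)"
      by (subst power2_norm_eq_inner, subst euclidean_inner) (simp add: power2_eq_square)
    then show ?thesis by (simp add: sum_distrib_left sum_negf flip: exp_sum)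
  qed
  then have "(\<integral>\<^sup>+x. ennreal (exp (- k * (norm (x::'a))\<^sup>2)) \<partial>lborel)
      = (\<integral>\<^sup>+x. (\<Prod>b\<in>Basis. ennreal (exp (- k * ((x::'a) \<bullet> b)\<^sup>2))) \<partial>lborel)"
    by (simp add: prod_ennreal)
  also have "\<dots> = (\<Prod>b\<in>(Basis::'a set). (\<integral>\<^sup>+x. ennreal (exp (- k * x\<^sup>2)) \<partial>lborel))"
    by (rule nn_integral_lborel_prod) auto
  also have "\<dots> < \<infinity>"
    using integrable_exp_neg_square[OF assms]
    by (auto simp: integrable_iff_bounded less_top[symmetric] ennreal_prod_eq_top power_eq_top_ennreal)
  finally show "(\<integral>\<^sup>+x. ennreal (exp (- k * (norm (x::'a))\<^sup>2)) \<partial>lborel) < \<infinity>" .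
qed auto

text \<open>Half of the quadratic term absorbs the linear one, at the cost of a constant factor; the
  other half leaves an integrable Gaussian. All majorants below have this form.\<close>

lemma integrable_exp_norm_minus_square:
  fixes b k :: real
  assumes "k > 0"
  shows "integrable lebesgue (\<lambda>x::'a::euclidean_space. exp (b * norm x - k * (norm x)\<^sup>2))"
proof -
  have "integrable lborel (\<lambda>x::'a. exp (b * norm x - k * (norm x)\<^sup>2))"
  proof (rule Bochner_Integration.integrable_bound)
    show "integrable lborel (\<lambda>x::'a. exp (b\<^sup>2 / (2 * k)) * exp (- (k / 2) * (norm x)\<^sup>2))"
      using assms by (intro integrable_mult_right integrable_exp_neg_norm_square) simp
    have "b * r - k * r\<^sup>2 \<le> b\<^sup>2 / (2 * k) + - (k / 2) * r\<^sup>2" for r :: real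
    proof -
      have "0 \<le> (b - k * r)\<^sup>2 / (2 * k)" using assms by simp
      also have "\<dots> = b\<^sup>2 / (2 * k) - b * r + k / 2 * r\<^sup>2"
        using assms by (simp add: field_simps power2_eq_square)
      finally show ?thesis by (simp add: algebra_simps)
    qed
    then show "AE x::'a in lborel. norm (exp (b * norm x - k * (norm x)\<^sup>2))
        \<le> norm (exp (b\<^sup>2 / (2 * k)) * exp (- (k / 2) * (norm x)\<^sup>2))"
      by (simp flip: exp_add)
  qed simp
  then show ?thesis by (subst integrable_completion) simp_all
qed

section \<open>Criteria for stationarity, coercivity and existence of minimizers\<close>

lemma GDERIV_zero_if_second_difference_le:
  fixes g :: "'a::real_inner \<Rightarrow> real"
  assumes min: "\<And>y. g x \<le> g y"
    and second: "\<And>h. norm h \<le> 1 \<Longrightarrow> g (x + h) + g (x - h) - 2 * g x \<le> K * (norm h)\<^sup>2"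
  shows "GDERIV g x :> 0"
proof -
  have bd: "norm (g (x + h) - g x) / norm h \<le> K * norm h" if "norm h \<le> 1" "h \<noteq> 0" for h
    using second[OF that(1)] min[of "x + h"] min[of "x - h"] that(2)
    by (simp add: field_simps power2_eq_square)
  have "((\<lambda>h. norm (g (x + h) - g x) / norm h) \<longlongrightarrow> 0) (at 0)"
  proof (rule tendsto_sandwich)
    show "\<forall>\<^sub>F h in at 0. 0 \<le> norm (g (x + h) - g x) / norm h" by simp
    show "\<forall>\<^sub>F h in at 0. norm (g (x + h) - g x) / norm h \<le> K * norm h"
      unfolding eventually_at using bd by (intro exI[of _ 1]) (auto simp: dist_norm)
    show "((\<lambda>h::'a. K * norm h) \<longlongrightarrow> 0) (at 0)"
      by (rule tendsto_eq_intros refl | simp)+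
  qed simp
  \<comment> \<open>For the zero gradient the linear part vanishes, so the remainder quotient in the
    definition of the derivative is the quotient just shown to tend to 0.\<close>
  then show ?thesis
    unfolding gderiv_def has_derivative_at by simp
qed

lemma coercive_if_quadratic_bound:
  fixes g :: "real ^ 'n \<Rightarrow> real"
  assumes "k > 0" and "\<And>x. norm x \<ge> 1 \<Longrightarrow> k * (norm x - 1)\<^sup>2 \<le> g x"
  shows "coercive g"
  unfolding coercive_def
proof (rule filterlim_at_top_mono)
  have "filterlim (\<lambda>r::real. k * (r - 1)\<^sup>2) at_top at_top"
    using assms(1) by real_asymp
  then show "filterlim (\<lambda>x::real ^ 'n. k * (norm x - 1)\<^sup>2) at_top at_infinity"
    by (rule filterlim_compose[OF _ filterlim_norm_at_top])
  show "\<forall>\<^sub>F x in at_infinity. k * (norm x - 1)\<^sup>2 \<le> g x"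
    unfolding eventually_at_infinity using assms(2) by blast
qed

lemma global_minimizer_exists:
  fixes g :: "real ^ 'n \<Rightarrow> real"
  assumes "coercive g" and "continuous_on UNIV g"
  shows "\<exists>x. global_minimizer g x"
proof -
  obtain R where R: "\<And>x. R \<le> norm x \<Longrightarrow> g 0 \<le> g x"
    using assms(1) unfolding coercive_def filterlim_at_top eventually_at_infinity by blast
  \<comment> \<open>Taking \<open>max R 0\<close> puts the origin in the ball, so the minimum over
    the ball is at most \<open>g 0\<close>, which in turn bounds \<open>g\<close> from below
    outside.\<close>
  have "0 \<in> cball (0::real ^ 'n) (max R 0)" by simp
  then obtain x where x: "\<And>y. y \<in> cball 0 (max R 0) \<Longrightarrow> g x \<le> g y"
    using continuous_attains_inf[of "cball 0 (max R 0)" g]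
      continuous_on_subset[OF assms(2) subset_UNIV] by (metis compact_cball empty_iff)
  have "g x \<le> g y" for y
    using x[of y] x[of 0] R[of y] by (cases "norm y \<le> max R 0") (auto simp: not_le)
  then show ?thesis unfolding is_arg_min_linorder by blast
qed

section \<open>Pointwise bounds for the heat kernel\<close>

lemma heat_kernel_pos:
  assumes "t > 0"
  shows "heat_kernel t y > 0"
  using assms by (simp add: heat_kernel_def)

lemma continuous_on_heat_kernel: "continuous_on S (heat_kernel t)"
  \<comment> \<open>Both denominators become constant factors, which avoids the nonzero side
    condition of the quotient rule.\<close>
  unfolding heat_kernel_def[abs_def] divide_inverse
  by (intro continuous_on_mult continuous_on_const continuous_on_exp continuous_on_minus
      continuous_on_power continuous_on_norm continuous_on_id)

lemma heat_kernel_measurable [measurable]: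
  "(\<lambda>y. heat_kernel t (x - y)) \<in> borel_measurable lebesgue"
proof -
  have "continuous_on UNIV (\<lambda>y. heat_kernel t (x - y))"
    by (intro continuous_on_compose2[OF continuous_on_heat_kernel[of UNIV]] continuous_intros) auto
  then show ?thesis
    by (intro measurable_completion) (simp add: borel_measurable_continuous_onI)
qed

text \<open>Expand the square, drop \<open>(norm x)\<^sup>2\<close> and apply Cauchy-Schwarz to the
  cross term. The majorant sees \<open>x\<close> only through \<open>R\<close>, as dominated
  convergence requires.\<close>

lemma heat_kernel_shift_le:
  fixes x y :: "real ^ 'n"
  assumes "t > 0" and "norm x \<le> R"
  shows "heat_kernel t (x - y)
    \<le> heat_kernel t (0 :: real ^ 'n) * exp (R / (2 * t) * norm y - 1 / (4 * t) * (norm y)\<^sup>2)"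
proof -
  have "x \<bullet> y \<le> R * norm y"
    using norm_cauchy_schwarz[of x y] mult_right_mono[OF assms(2), of "norm y"] by simp
  moreover have "(norm (x - y))\<^sup>2 = (norm x)\<^sup>2 - 2 * (x \<bullet> y) + (norm y)\<^sup>2"
    by (simp add: power2_norm_eq_inner inner_diff inner_commute)
  ultimately have "(norm y)\<^sup>2 - 2 * R * norm y \<le> (norm (x - y))\<^sup>2"
    using zero_le_power2[of "norm x"] by linarith
  then have "- (norm (x - y))\<^sup>2 / (4 * t) \<le> (2 * R * norm y - (norm y)\<^sup>2) / (4 * t)"
    using assms(1) by (intro divide_right_mono) auto
  also have "\<dots> = R / (2 * t) * norm y - 1 / (4 * t) * (norm y)\<^sup>2"
    using assms(1) by (simp add: field_simps)
  finally show ?thesis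
    using assms(1) by (auto simp: heat_kernel_def intro!: divide_right_mono)
qed

lemma heat_kernel_mult_le:
  fixes x y :: "real ^ 'n"
  assumes "t > 0" and "norm x \<le> R" and "\<bar>v\<bar> \<le> M * exp (b * norm y)"
  shows "\<bar>heat_kernel t (x - y) * v\<bar>
    \<le> heat_kernel t (0 :: real ^ 'n) * M
        * exp ((R / (2 * t) + b) * norm y - 1 / (4 * t) * (norm y)\<^sup>2)"
proof -
  have "\<bar>heat_kernel t (x - y) * v\<bar> = heat_kernel t (x - y) * \<bar>v\<bar>"
    using heat_kernel_pos[OF assms(1), of "x - y"] by (simp add: abs_mult)
  also have "\<dots> \<le> (heat_kernel t (0 :: real ^ 'n)
      * exp (R / (2 * t) * norm y - 1 / (4 * t) * (norm y)\<^sup>2)) * (M * exp (b * norm y))"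
    using heat_kernel_shift_le[OF assms(1,2), of y] assms(3)
      heat_kernel_pos[OF assms(1), of "x - y"] by (intro mult_mono) auto
  also have "\<dots> = heat_kernel t (0 :: real ^ 'n) * M
        * exp ((R / (2 * t) + b) * norm y - 1 / (4 * t) * (norm y)\<^sup>2)"
    by (simp add: algebra_simps flip: exp_add)
  finally show ?thesis .
qed

section \<open>Integrability, continuity and lower bounds for the regularization\<close>

lemma heat_reg_integrable:
  fixes g :: "real ^ 'n \<Rightarrow> real"
  assumes "t > 0" and [measurable]: "g \<in> borel_measurable lebesgue"
    and "\<And>y. \<bar>g y\<bar> \<le> M * exp (b * norm y)"
  shows "integrable lebesgue (\<lambda>y. heat_kernel t (x - y) * g y)"
proof (rule Bochner_Integration.integrable_bound)
  show "integrable lebesgue (\<lambda>y. heat_kernel t (0 :: real ^ 'n) * M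
      * exp ((norm x / (2 * t) + b) * norm (y :: real ^ 'n) - 1 / (4 * t) * (norm y)\<^sup>2))"
    using assms(1) by (intro integrable_mult_right integrable_exp_norm_minus_square) simp
  show "AE y in lebesgue. norm (heat_kernel t (x - y) * g y) \<le> norm (heat_kernel t (0 :: real ^ 'n) * M
      * exp ((norm x / (2 * t) + b) * norm (y :: real ^ 'n) - 1 / (4 * t) * (norm y)\<^sup>2))"
    unfolding real_norm_def
    by (intro AE_I2 order_trans[OF heat_kernel_mult_le[OF assms(1) order_refl assms(3)] abs_ge_self])
qed simp

lemma continuous_on_heat_reg:
  fixes g :: "real ^ 'n \<Rightarrow> real"
  assumes "t > 0" and [measurable]: "g \<in> borel_measurable lebesgue"
    and "\<And>y. \<bar>g y\<bar> \<le> M * exp (b * norm y)"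
  shows "continuous_on UNIV (heat_reg t g)"
  unfolding continuous_on_sequentially
proof safe
  fix X :: "nat \<Rightarrow> real ^ 'n" and x
  assume X: "X \<longlonglongrightarrow> x"
  \<comment> \<open>A convergent sequence is bounded, so one majorant serves all
    \<open>X n\<close>.\<close>
  then obtain R where R: "\<And>n. norm (X n) \<le> R"
    using convergent_imp_Bseq[of X] by (auto simp: convergent_def Bseq_def)
  show "(heat_reg t g \<circ> X) \<longlonglongrightarrow> heat_reg t g x"
    unfolding heat_reg_def o_def
  proof (rule integral_dominated_convergence)
    show "integrable lebesgue (\<lambda>y. heat_kernel t (0 :: real ^ 'n) * M
        * exp ((R / (2 * t) + b) * norm (y :: real ^ 'n) - 1 / (4 * t) * (norm y)\<^sup>2))"
      using assms(1) by (intro integrable_mult_right integrable_exp_norm_minus_square) simp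
    show "AE y in lebesgue. norm (heat_kernel t (X n - y) * g y) \<le> heat_kernel t (0 :: real ^ 'n) * M
        * exp ((R / (2 * t) + b) * norm y - 1 / (4 * t) * (norm y)\<^sup>2)" for n
      using heat_kernel_mult_le[OF assms(1) R assms(3)] by simp
    have "(\<lambda>n. heat_kernel t (X n - y)) \<longlonglongrightarrow> heat_kernel t (x - y)" for y
      by (intro continuous_on_tendsto_compose[OF continuous_on_heat_kernel[of UNIV]]
          tendsto_intros X) auto
    then show "AE y in lebesgue. (\<lambda>n. heat_kernel t (X n - y) * g y) \<longlonglongrightarrow> heat_kernel t (x - y) * g y"
      by (intro AE_I2 tendsto_mult_right)
  qed simp_all
qed

text \<open>The integrand is nonnegative, so the part outside the unit ball around \<open>x\<close>
  may be discarded; inside, the kernel is at least its value at distance 1.\<close>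

lemma heat_reg_ge_unit_ball:
  fixes g :: "real ^ 'n \<Rightarrow> real"
  assumes "t > 0" and "integrable lebesgue (\<lambda>y. heat_kernel t (x - y) * g y)"
    and "\<And>y. 0 \<le> g y" and "\<And>y. y \<in> ball x 1 \<Longrightarrow> v \<le> g y"
  shows "heat_kernel t (0 :: real ^ 'n) * exp (- 1 / (4 * t)) * unit_ball_vol (CARD('n)) * v
    \<le> heat_reg t g x"
proof (cases "v \<ge> 0")
  case True
  define c where "c = heat_kernel t (0 :: real ^ 'n) * exp (- 1 / (4 * t))"
  have ge: "c \<le> heat_kernel t (x - y)" if "y \<in> ball x 1" for y
  proof -
    have "(norm (x - y))\<^sup>2 \<le> 1"
      using that by (simp add: dist_norm power_le_one)
    then show ?thesis using assms(1)
      by (auto simp: c_def heat_kernel_def divide_simps)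
  qed
  have ball: "ball x 1 \<in> lmeasurable" by simp
  have "c * v * measure lebesgue (ball x 1) = (LINT y|lebesgue. indicat_real (ball x 1) y * (c * v))"
    by simp
  also have "\<dots> \<le> heat_reg t g x"
    unfolding heat_reg_def
  proof (rule integral_mono)
    show "integrable lebesgue (\<lambda>y. indicat_real (ball x 1) y * (c * v))"
      using ball by (intro integrable_mult_left integrable_real_indicator)
        (auto simp: fmeasurable_def)
    show "indicat_real (ball x 1) y * (c * v) \<le> heat_kernel t (x - y) * g y" for y
      using ge[of y] assms(3)[of y] assms(4)[of y] True heat_kernel_pos[OF assms(1), of "x - y"]
      by (auto simp: indicator_def intro!: mult_mono)
  qed (rule assms(2))
  finally show ?thesis
    by (simp add: content_ball c_def mult_ac)
next
  \<comment> \<open>For negative \<open>v\<close> the left side is nonpositive and the integral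
    nonnegative.\<close>
  case False
  have "heat_kernel t (0 :: real ^ 'n) * exp (- 1 / (4 * t)) * unit_ball_vol (CARD('n)) * v \<le> 0"
    using False heat_kernel_pos[OF assms(1), of "0 :: real ^ 'n"]
    by (intro mult_nonneg_nonpos mult_nonneg_nonneg) auto
  also have "0 \<le> heat_reg t g x"
    unfolding heat_reg_def using assms(3) less_imp_le[OF heat_kernel_pos[OF assms(1)]]
    by (intro integral_nonneg_AE AE_I2 mult_nonneg_nonneg)
  finally show ?thesis .
qed

section \<open>Second differences of the kernel and of the regularization\<close>

text \<open>In the second-order Taylor expansions at \<open>u\<close> and \<open>- u\<close> the
  linear terms cancel and the two remainders add up.\<close>

lemma exp_second_difference_le:
  fixes u :: real
  shows "exp u + exp (- u) - 2 \<le> u\<^sup>2 * exp \<bar>u\<bar>"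
proof -
  have *: "exp s \<le> 1 + s + s\<^sup>2 / 2 * exp \<bar>s\<bar>" for s :: real
  proof -
    obtain r where r: "\<bar>r\<bar> \<le> \<bar>s\<bar>" "exp s = 1 + s + exp r / 2 * s\<^sup>2"
      using Maclaurin_exp_le[of s 2] by (auto simp: numeral_2_eq_2)
    have "exp r \<le> exp \<bar>s\<bar>" using r(1) by simp
    then have "exp r * s\<^sup>2 \<le> exp \<bar>s\<bar> * s\<^sup>2" by (intro mult_right_mono) auto
    then show ?thesis using r(2) by (simp add: algebra_simps)
  qed
  show ?thesis using *[of u] *[of "- u"] by simp
qed

text \<open>With \<open>u\<close> as below, shifting \<open>z\<close> by \<open>h\<close> or
  \<open>- h\<close> multiplies the kernel by \<open>exp (- u)\<close> or \<open>exp u\<close>, up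
  to a common factor at most 1 that is dropped. The second difference of \<open>exp\<close> then
  supplies the square of \<open>norm h\<close>.\<close>

lemma heat_kernel_second_difference_le:
  fixes z h :: "real ^ 'n"
  assumes "t > 0" and "norm h \<le> 1"
  shows "heat_kernel t (z + h) + heat_kernel t (z - h) - 2 * heat_kernel t z
    \<le> heat_kernel t z * (2 * exp (norm z / t)) * (norm h)\<^sup>2"
proof -
  define u where "u = z \<bullet> h / (2 * t)"
  define w where "w = norm z / (2 * t)"
  have w: "0 \<le> w" using assms(1) by (simp add: w_def)
  have "\<bar>z \<bullet> h\<bar> \<le> norm z * norm h" by (rule Cauchy_Schwarz_ineq2)
  then have u: "\<bar>u\<bar> \<le> w * norm h"
    using assms(1) by (simp add: u_def w_def field_simps)
  have "w * norm h \<le> w * 1" using w assms(2) by (intro mult_left_mono)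
  with u have u': "\<bar>u\<bar> \<le> w" by simp
  have shift: "heat_kernel t (z + s *\<^sub>R h) \<le> heat_kernel t z * exp (- (s * u))"
    if "s\<^sup>2 = 1" for s
  proof -
    have "(norm (z + s *\<^sub>R h))\<^sup>2 = (norm z)\<^sup>2 + 2 * s * (z \<bullet> h) + s\<^sup>2 * (norm h)\<^sup>2"
      by (simp only: power2_norm_eq_inner)
        (simp add: inner_add inner_commute power2_eq_square algebra_simps)
    then have "(norm z)\<^sup>2 + 2 * s * (z \<bullet> h) \<le> (norm (z + s *\<^sub>R h))\<^sup>2" by (simp add: that)
    then have "- (norm (z + s *\<^sub>R h))\<^sup>2 / (4 * t) \<le> - ((norm z)\<^sup>2 + 2 * s * (z \<bullet> h)) / (4 * t)"
      using assms(1) by (intro divide_right_mono) auto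
    also have "\<dots> = - (norm z)\<^sup>2 / (4 * t) + - (s * u)"
      using assms(1) by (simp add: u_def field_simps)
    finally have "exp (- (norm (z + s *\<^sub>R h))\<^sup>2 / (4 * t))
        \<le> exp (- (norm z)\<^sup>2 / (4 * t)) * exp (- (s * u))"
      by (simp flip: exp_add)
    then show ?thesis
      using assms(1) by (auto simp: heat_kernel_def intro!: divide_right_mono)
  qed
  \<comment> \<open>This trades the polynomial factor \<open>w\<^sup>2\<close> for an exponential;
    the two factors \<open>exp w\<close> combine to \<open>exp (norm z / t)\<close>.\<close>
  have "w\<^sup>2 / 2 \<le> exp w"
    using exp_lower_Taylor_quadratic[OF w] w by linarith
  then have "u\<^sup>2 * exp \<bar>u\<bar> \<le> (w * norm h)\<^sup>2 * exp w"
    using u u' by (intro mult_mono) (auto simp: abs_le_square_iff[symmetric] w)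
  also have "\<dots> = w\<^sup>2 * exp w * (norm h)\<^sup>2"
    by (simp add: power_mult_distrib)
  also have "\<dots> \<le> (2 * exp w) * exp w * (norm h)\<^sup>2"
    using \<open>w\<^sup>2 / 2 \<le> exp w\<close> by (intro mult_right_mono) auto
  also have "\<dots> = 2 * exp (norm z / t) * (norm h)\<^sup>2"
    by (simp add: w_def flip: exp_add)
  finally have cosh: "exp u + exp (- u) - 2 \<le> 2 * exp (norm z / t) * (norm h)\<^sup>2"
    using exp_second_difference_le[of u] by linarith
  have "heat_kernel t (z + h) + heat_kernel t (z - h) - 2 * heat_kernel t z
      \<le> heat_kernel t z * (exp u + exp (- u) - 2)"
    using shift[of 1] shift[of "- 1"] by (simp add: algebra_simps)
  also have "\<dots> \<le> heat_kernel t z * (2 * exp (norm z / t) * (norm h)\<^sup>2)"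
    using cosh heat_kernel_pos[OF assms(1), of z] by (intro mult_left_mono) auto
  finally show ?thesis by (simp add: mult_ac)
qed

lemma heat_reg_second_difference_le:
  fixes g :: "real ^ 'n \<Rightarrow> real"
  assumes "t > 0" and [measurable]: "g \<in> borel_measurable lebesgue"
    and bound: "\<And>y. \<bar>g y\<bar> \<le> M * exp (b * norm y)" and nonneg: "\<And>y. 0 \<le> g y"
  shows "\<exists>K. \<forall>h. norm h \<le> 1 \<longrightarrow>
    heat_reg t g (x + h) + heat_reg t g (x - h) - 2 * heat_reg t g x \<le> K * (norm h)\<^sup>2"
proof -
  \<comment> \<open>The exponential weight from the kernel estimate is moved into the function.
    \<open>G\<close> still grows at most exponentially, so \<open>K\<close> can be the finite value
    \<open>heat_reg t G x\<close>.\<close>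
  define G where "G y = 2 * exp (norm (x - y) / t) * g y" for y
  have int: "integrable lebesgue (\<lambda>y. heat_kernel t (z - y) * g y)" for z
    using heat_reg_integrable[OF assms(1-3)] .
  have "integrable lebesgue (\<lambda>y. heat_kernel t (x - y) * G y)"
  proof (rule heat_reg_integrable[OF assms(1)])
    have "(\<lambda>y. exp (norm (x - y) / t)) \<in> borel_measurable lebesgue"
      by (intro measurable_completion) simp
    then show "G \<in> borel_measurable lebesgue" unfolding G_def by simp
    show "\<bar>G y\<bar> \<le> 2 * exp (norm x / t) * M * exp ((1 / t + b) * norm y)" for y
    proof -
      have "norm (x - y) / t \<le> norm x / t + norm y / t"
        using norm_triangle_ineq4[of x y] assms(1) by (simp add: divide_right_mono flip: add_divide_distrib)
      then have "exp (norm (x - y) / t) \<le> exp (norm x / t) * exp (norm y / t)"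
        by (simp flip: exp_add)
      then have "exp (norm (x - y) / t) * \<bar>g y\<bar>
          \<le> (exp (norm x / t) * exp (norm y / t)) * (M * exp (b * norm y))"
        using bound by (intro mult_mono) auto
      also have "\<dots> = exp (norm x / t) * M * exp ((1 / t + b) * norm y)"
        by (simp add: algebra_simps exp_add)
      finally show ?thesis by (simp add: G_def abs_mult)
    qed
  qed
  note intG = this
  have "heat_reg t g (x + h) + heat_reg t g (x - h) - 2 * heat_reg t g x
      \<le> heat_reg t G x * (norm h)\<^sup>2" if h: "norm h \<le> 1" for h
  proof -
    have "heat_reg t g (x + h) + heat_reg t g (x - h) - 2 * heat_reg t g x
      = (LINT y|lebesgue. heat_kernel t (x + h - y) * g y + heat_kernel t (x - h - y) * g y
            - 2 * (heat_kernel t (x - y) * g y))"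
      unfolding heat_reg_def using int by simp
    also have "\<dots> \<le> (LINT y|lebesgue. heat_kernel t (x - y) * G y * (norm h)\<^sup>2)"
    proof (rule integral_mono)
      fix y
      \<comment> \<open>Nonnegativity of \<open>g\<close> preserves the direction of the kernel
        inequality.\<close>
      have "(heat_kernel t (x + h - y) + heat_kernel t (x - h - y) - 2 * heat_kernel t (x - y)) * g y
        \<le> heat_kernel t (x - y) * (2 * exp (norm (x - y) / t)) * (norm h)\<^sup>2 * g y"
        using heat_kernel_second_difference_le[OF assms(1) h, of "x - y"] nonneg[of y]
        by (intro mult_right_mono) (auto simp: algebra_simps)
      then show "heat_kernel t (x + h - y) * g y + heat_kernel t (x - h - y) * g y
            - 2 * (heat_kernel t (x - y) * g y) \<le> heat_kernel t (x - y) * G y * (norm h)\<^sup>2"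
        by (simp add: G_def algebra_simps)
    qed (intro Bochner_Integration.integrable_diff Bochner_Integration.integrable_add
        integrable_mult_left integrable_mult_right int intG)+
    also have "\<dots> = heat_reg t G x * (norm h)\<^sup>2"
      unfolding heat_reg_def by simp
    finally show ?thesis .
  qed
  then show ?thesis by blast
qed

section \<open>Application to functions with quadratic lower bound and polynomial tail\<close>

text \<open>From \<open>ln r \<le> r\<close> follows \<open>r powr m \<le> exp (m * r)\<close> for
  positive \<open>r\<close>; at 0 the power is 0 by convention.\<close>

lemma polynomial_tail_exp_bound:
  fixes f :: "real ^ 'n \<Rightarrow> real"
  assumes "polynomial_tail f"
  shows "\<exists>M b. \<forall>y. f y \<le> M * exp (b * norm y)"
proof -
  obtain C m where C: "C > 0" "m \<ge> 2" "\<And>x. f x \<le> C * (1 + norm x powr m)"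
    using assms unfolding polynomial_tail_def by blast
  have "f y \<le> 2 * C * exp (m * norm y)" for y
  proof -
    have "norm y powr m \<le> exp (m * norm y)"
    proof (cases "y = 0")
      case False
      then have "ln (norm y) \<le> norm y" using ln_bound[of "norm y"] by simp
      then show ?thesis using False C(2) by (simp add: powr_def mult_left_mono)
    qed simp
    moreover have "1 \<le> exp (m * norm y)" using C(2) by simp
    ultimately have "1 + norm y powr m \<le> 2 * exp (m * norm y)" by linarith
    then have "C * (1 + norm y powr m) \<le> C * (2 * exp (m * norm y))"
      using C(1) by (intro mult_left_mono) auto
    then show ?thesis using C(3)[of y] by simp
  qed
  then show ?thesis by blast
qed

theorem corollary4p2:
  fixes f :: "real ^ 'n \<Rightarrow> real"
  assumes "f \<in> borel_measurable lebesgue"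
    and "quadratic_lower_bound f"
    and "leading_order_profile f"
    and "polynomial_tail f"
  shows "\<forall>t>0. coercive (heat_reg t f)
    \<and> (\<exists>x. global_minimizer (heat_reg t f) x)
    \<and> (\<forall>x. global_minimizer (heat_reg t f) x \<longrightarrow> GDERIV (heat_reg t f) x :> 0)"
proof (intro allI impI)
  fix t :: real
  assume t: "t > 0"
  obtain c where c: "c > 0" "\<And>x. c * (norm x)\<^sup>2 \<le> f x"
    using assms(2) unfolding quadratic_lower_bound_def by blast
  have nonneg: "0 \<le> f y" for y
    using c(1) by (intro order_trans[OF _ c(2)]) simp
  obtain M b where "\<And>y. f y \<le> M * exp (b * norm y)"
    using polynomial_tail_exp_bound[OF assms(4)] by blast
  then have bound: "\<bar>f y\<bar> \<le> M * exp (b * norm y)" for y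
    using nonneg[of y] by simp
  \<comment> \<open>This is the constant of the unit ball estimate for
    \<open>v = c * (norm x - 1)\<^sup>2\<close>: every point of the ball has norm at least
    \<open>norm x - 1\<close>.\<close>
  define k where "k = heat_kernel t (0 :: real ^ 'n) * exp (- 1 / (4 * t)) * unit_ball_vol (CARD('n)) * c"
  have "coercive (heat_reg t f)"
  proof (rule coercive_if_quadratic_bound)
    show "k > 0" using c(1) heat_kernel_pos[OF t, of "0 :: real ^ 'n"] by (simp add: k_def)
    fix x :: "real ^ 'n"
    assume x: "1 \<le> norm x"
    have "c * (norm x - 1)\<^sup>2 \<le> f y" if "y \<in> ball x 1" for y
    proof -
      have "norm x - 1 \<le> norm y"
        using that norm_triangle_ineq2[of x y] by (simp add: dist_norm)
      then have "c * (norm x - 1)\<^sup>2 \<le> c * (norm y)\<^sup>2"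
        using x c(1) by (intro mult_left_mono power_mono) auto
      with c(2)[of y] show ?thesis by linarith
    qed
    then show "k * (norm x - 1)\<^sup>2 \<le> heat_reg t f x"
      using heat_reg_ge_unit_ball[OF t heat_reg_integrable[OF t assms(1) bound] nonneg]
      by (simp add: k_def mult.assoc)
  qed
  moreover have "\<exists>x. global_minimizer (heat_reg t f) x"
    using calculation continuous_on_heat_reg[OF t assms(1) bound] by (rule global_minimizer_exists)
  moreover have "GDERIV (heat_reg t f) x :> 0" if "global_minimizer (heat_reg t f) x" for x
    using that heat_reg_second_difference_le[OF t assms(1) bound nonneg, of x]
    by (auto simp: is_arg_min_linorder intro: GDERIV_zero_if_second_difference_le)
  ultimately show "coercive (heat_reg t f)
    \<and> (\<exists>x. global_minimizer (heat_reg t f) x)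
    \<and> (\<forall>x. global_minimizer (heat_reg t f) x \<longrightarrow> GDERIV (heat_reg t f) x :> 0)"
    by blast
qed

end
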